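(* For $|q|<1$, $$\sum_{n=1}^{\infty} R_4(n)\, q^n = \frac{q^{10}\left(1+4q+6q^2+7q^3+6q^4+2q^5-5q^7-5q^8-5q^9+q^{11}+3q^{12}+2q^{13}-q^{16}\right)}{(1-q)(1-q^2)(1-q^3)(1-q^4)},$$ where $R_4(n)$ is the number of partitions of $n$ with max-rook number $4$.
   Context: A partition $\pi$ of a positive integer $n$ is a non-increasing sequence of positive integers $(\lambda_1,\dots,\lambda_r)$ with sum $n$; $\mathscr{P}(n)$ is the set of all partitions of $n$. The Ferrers board $B_\pi$ of $\pi=(\lambda_1,\dots,\lambda_r)$ is the left-justified array of unit squares with $r$ rows whose $i$-th row from the top has $\lambda_i$ squares. Rooks placed on squares of the board are non-intersecting if no two of them lie in the same row or the same column. The max-rook number $R(\pi)$ is the maximal number of non-intersecting rooks that can be placed in $B_\pi$. For positive integers $n,k$, $R_k(n):=\#\{\pi\in\mathscr{P}(n) : R(\pi)=k\}$. *)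

theory Defs
  imports Complex_Main
begin

definition partitions_of :: "nat \<Rightarrow> nat list set" where
  "partitions_of n = {p. sorted_wrt (\<ge>) p \<and> (\<forall>x\<in>set p. 0 < x) \<and> sum_list p = n}"

(* A square is a pair (row, column), both counted from 0. *)
definition ferrers_board :: "nat list \<Rightarrow> (nat \<times> nat) set" where
  "ferrers_board p = {(i, j). i < length p \<and> j < p ! i}"

definition non_intersecting :: "(nat \<times> nat) set \<Rightarrow> bool" where
  "non_intersecting S \<longleftrightarrow>
     (\<forall>s\<in>S. \<forall>t\<in>S. s \<noteq> t \<longrightarrow> fst s \<noteq> fst t \<and> snd s \<noteq> snd t)"

definition max_rook :: "nat list \<Rightarrow> nat" where
  "max_rook p = Max {card S | S. S \<subseteq> ferrers_board p \<and> non_intersecting S}"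

definition rook_count :: "nat \<Rightarrow> nat \<Rightarrow> nat" where
  "rook_count k n = card {p \<in> partitions_of n. max_rook p = k}"

end

theory Submission
  imports Defs "HOL-Analysis.Infinite_Sum" "HOL-Analysis.Elementary_Metric_Spaces"
begin

text \<open>
  Placing the rows of a Ferrers board from the bottom upwards, a new first row of length \<open>x\<close>
  turns the max-rook number \<open>r\<close> into \<open>min x (r + 1)\<close>: there are only \<open>x\<close> columns, a row holds at
  most one rook, and as long as \<open>r < x\<close> the new row has a free column
  (\<open>max_rook_eq_rook_of\<close>). Let \<open>S k m\<close> be the set of partitions with parts at most \<open>m\<close> and max-rook
  number \<open>k\<close>. Removing the largest part gives, for \<open>m > k \<ge> 1\<close>,
  \<open>S k m = S k (m - 1) \<union> {m # p | p \<in> S (k - 1) m}\<close>, while an element of \<open>S k k\<close> is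
  a positive number of parts \<open>k\<close> followed by an element of \<open>S (k - 1) k\<close>.

  Hence the generating functions \<open>G k m\<close> of \<open>S k m\<close> satisfy \<open>G 0 m = 1\<close>, \<open>G k m - G k (m - 1) = q^m G (k - 1) m\<close>
  for \<open>m > k\<close>, and \<open>G k k = q^k / (1 - q^k) G (k - 1) k\<close> for \<open>k \<ge> 1\<close>. The difference equation is solved by
  \<open>G k m = (\<Sum>j\<le>k. A (k - j) c\<^sub>j q^(j m))\<close> with
  \<open>c\<^sub>j = (-1)^j q^(j (j + 1) / 2) / ((1 - q) \<dots> (1 - q^j))\<close>, for any sequence \<open>A\<close> with \<open>A 0 = 1\<close>; the boundary
  value at \<open>m = k\<close> then determines \<open>A k\<close> from \<open>A 0, \<dots>, A (k - 1)\<close>. Letting \<open>m\<close> tend to infinity,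
  only the term \<open>j = 0\<close> survives, so \<open>A k\<close> is the generating function of all partitions with
  max-rook number \<open>k\<close> (\<open>rook_count_sums\<close>), for every \<open>k\<close>. Unrolling the recursion up to
  \<open>k = 4\<close> gives the stated rational function (\<open>rook_gf_4\<close>).
\<close>

section \<open>The max-rook number of a Ferrers board\<close>

text \<open>The max-rook number, computed row by row from the bottom of the board. On
  non-increasing lists it agrees with \<open>max_rook\<close>.\<close>

fun rook_of :: "nat list \<Rightarrow> nat" where
  "rook_of [] = 0"
| "rook_of (x # p) = min x (Suc (rook_of p))"

lemma rook_of_le_bound: "(\<forall>x\<in>set p. x \<le> m) \<Longrightarrow> rook_of p \<le> m"
  by (cases p) auto

lemma finite_ferrers_board: "finite (ferrers_board p)"
proof (rule finite_subset)
  show "ferrers_board p \<subseteq> {..<length p} \<times> {..<Suc (sum_list p)}"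
    unfolding ferrers_board_def
    by (auto simp: less_Suc_eq_le intro: order.trans[OF less_imp_le elem_le_sum_list])
qed simp

text \<open>Since rows are counted from \<open>0\<close>, prepending a row shifts the old board by one.\<close>

lemma ferrers_board_Cons:
  "ferrers_board (x # p) = Pair 0 ` {..<x} \<union> map_prod Suc id ` ferrers_board p"
proof (rule set_eqI)
  fix s :: "nat \<times> nat"
  obtain i j where s: "s = (i, j)" by (cases s)
  show "s \<in> ferrers_board (x # p) \<longleftrightarrow>
    s \<in> Pair 0 ` {..<x} \<union> map_prod Suc id ` ferrers_board p"
    unfolding s ferrers_board_def
    by (cases i) (auto simp: image_iff)
qed

lemma card_placement_le:
  assumes "sorted_wrt (\<ge>) p" "S \<subseteq> ferrers_board p" "non_intersecting S"
  shows "card S \<le> rook_of p"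
  using assms
proof (induction p arbitrary: S)
  case Nil
  then show ?case by (simp add: ferrers_board_def)
next
  case (Cons x p)
  have fin: "finite S"
    using Cons.prems(2) finite_ferrers_board finite_subset by blast
  have cols: "snd ` S \<subseteq> {..<x}"
  proof
    fix j assume "j \<in> snd ` S"
    then obtain i where "i < length (x # p)" "j < (x # p) ! i"
      using Cons.prems(2) by (auto simp: ferrers_board_def)
    moreover from this(1) have "(x # p) ! i \<le> x"
      using Cons.prems(1) by (cases i) auto
    ultimately show "j \<in> {..<x}" by simp
  qed
  have "inj_on snd S"
    using Cons.prems(3) unfolding non_intersecting_def inj_on_def by blast
  then have le_x: "card S \<le> x"
    using card_mono[OF _ cols] card_image[of snd S] by simp
  define T where "T = map_prod Suc id -` S"
  have inj: "inj (map_prod Suc (id :: nat \<Rightarrow> nat))"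
    by (simp add: prod.inj_map)
  have T_board: "T \<subseteq> ferrers_board p"
    using Cons.prems(2) unfolding T_def ferrers_board_def by fastforce
  have T_non: "non_intersecting T"
    unfolding non_intersecting_def
  proof (intro ballI impI)
    fix s t assume st: "s \<in> T" "t \<in> T" "s \<noteq> t"
    then have "map_prod Suc id s \<in> S" "map_prod Suc id t \<in> S"
      "map_prod Suc id s \<noteq> map_prod Suc id t"
      by (simp_all add: T_def inj_eq[OF inj])
    then have "fst (map_prod Suc id s) \<noteq> fst (map_prod Suc id t) \<and>
        snd (map_prod Suc id s) \<noteq> snd (map_prod Suc id t)"
      using Cons.prems(3) unfolding non_intersecting_def by blast
    then show "fst s \<noteq> fst t \<and> snd s \<noteq> snd t" by simp
  qed
  have card_T: "card T \<le> rook_of p"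
    using Cons.IH T_board T_non Cons.prems(1) by simp
  have fin_T: "finite T"
    using T_board finite_ferrers_board finite_subset by blast
  have "s = t" if "s \<in> S \<inter> Pair 0 ` {..<x}" "t \<in> S \<inter> Pair 0 ` {..<x}" for s t
    using that Cons.prems(3) unfolding non_intersecting_def by (metis IntE fst_conv imageE)
  then have row: "card (S \<inter> Pair 0 ` {..<x}) \<le> Suc 0"
    using fin by (subst card_le_Suc0_iff_eq) auto
  have "S \<subseteq> (S \<inter> Pair 0 ` {..<x}) \<union> map_prod Suc id ` T"
    using Cons.prems(2) unfolding ferrers_board_Cons T_def by (auto 0 3)
  then have "card S \<le> card ((S \<inter> Pair 0 ` {..<x}) \<union> map_prod Suc id ` T)"
    using fin fin_T by (intro card_mono) auto
  also have "\<dots> \<le> card (S \<inter> Pair 0 ` {..<x}) + card (map_prod Suc id ` T)"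
    by (rule card_Un_le)
  also have "\<dots> \<le> Suc (rook_of p)"
    using row card_T card_image_le[OF fin_T, of "map_prod Suc id"] by linarith
  finally show ?case using le_x by simp
qed

lemma placement_exists:
  assumes "sorted_wrt (\<ge>) p"
  shows "\<exists>S. S \<subseteq> ferrers_board p \<and> non_intersecting S \<and> card S = rook_of p"
  using assms
proof (induction p)
  case Nil
  then show ?case by (intro exI[of _ "{}"]) (simp add: non_intersecting_def)
next
  case (Cons x p)
  then obtain T where T: "T \<subseteq> ferrers_board p" "non_intersecting T" "card T = rook_of p"
    by auto
  have le: "rook_of p \<le> x"
    using Cons.prems by (intro rook_of_le_bound) auto
  define U where "U = map_prod Suc (id :: nat \<Rightarrow> nat) ` T"
  have fin_T: "finite T"
    using T(1) finite_ferrers_board finite_subset by blast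
  have card_U: "card U = rook_of p"
    unfolding U_def using T(3) by (subst card_image) (auto simp: inj_on_def)
  have U_non: "non_intersecting U"
    using T(2) by (simp add: U_def non_intersecting_def prod_eq_iff)
  have U_board: "U \<subseteq> ferrers_board (x # p)"
    using T(1) unfolding U_def ferrers_board_Cons by blast
  show ?case
  proof (cases "rook_of p = x")
    case True
    then have "card U = rook_of (x # p)" using card_U by simp
    then show ?thesis using U_non U_board by blast
  next
    case False
    \<comment> \<open>Some column of the new row is unoccupied; the next rook goes there.\<close>
    have "card (snd ` U) < card {..<x}"
      using card_image_le[of U snd] fin_T card_U le False by (simp add: U_def)
    then have "\<not> {..<x} \<subseteq> snd ` U"
      using card_mono[of "snd ` U" "{..<x}"] fin_T by (auto simp: U_def)
    then obtain j where j: "j < x" "j \<notin> snd ` U" by auto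
    have new: "(0, j) \<notin> U" by (auto simp: U_def)
    have "non_intersecting (insert (0, j) U)"
      unfolding non_intersecting_def
    proof (intro ballI impI)
      fix s t assume st: "s \<in> insert (0, j) U" "t \<in> insert (0, j) U" "s \<noteq> t"
      have "fst u \<noteq> 0 \<and> snd u \<noteq> j" if "u \<in> U" for u
        using that j(2) by (auto simp: U_def)
      then show "fst s \<noteq> fst t \<and> snd s \<noteq> snd t"
        using st U_non unfolding non_intersecting_def by (metis fst_conv insertE snd_conv)
    qed
    moreover have "insert (0, j) U \<subseteq> ferrers_board (x # p)"
      using U_board j(1) unfolding ferrers_board_Cons by auto
    moreover have "card (insert (0, j) U) = rook_of (x # p)"
      using new fin_T card_U le False by (simp add: U_def)
    ultimately show ?thesis by blast
  qed
qed

lemma max_rook_eq_rook_of: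
  assumes "sorted_wrt (\<ge>) p"
  shows "max_rook p = rook_of p"
proof -
  let ?C = "{card S |S. S \<subseteq> ferrers_board p \<and> non_intersecting S}"
  have le: "n \<le> rook_of p" if "n \<in> ?C" for n
    using that card_placement_le[OF assms] by blast
  moreover have "finite ?C"
    by (rule finite_subset[of _ "{..rook_of p}"]) (use le in auto)
  moreover have "rook_of p \<in> ?C"
    using placement_exists[OF assms] by (metis (mono_tags, lifting) mem_Collect_eq)
  ultimately show ?thesis unfolding max_rook_def by (intro Max_eqI)
qed

section \<open>Partitions with bounded parts and given rook number\<close>

text \<open>Partitions (of any integer) with all parts at most \<open>m\<close> and max-rook number \<open>k\<close>.\<close>

definition rook_class :: "nat \<Rightarrow> nat \<Rightarrow> nat list set" where
  "rook_class k m = {p. sorted_wrt (\<ge>) p \<and> set p \<subseteq> {1..m} \<and> rook_of p = k}"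

lemma rook_class_empty:
  assumes "m < k"
  shows "rook_class k m = {}"
proof -
  have "rook_of p \<le> m" if "set p \<subseteq> {1..m}" for p
    using that by (intro rook_of_le_bound) auto
  then show ?thesis using assms by (fastforce simp: rook_class_def)
qed

lemma rook_class_0: "rook_class 0 m = {[]}"
proof -
  have "p = []" if "p \<in> rook_class 0 m" for p
    using that unfolding rook_class_def by (cases p) auto
  then show ?thesis by (auto simp: rook_class_def)
qed

text \<open>The rook number of \<open>p\<close> is at most \<open>x\<close> once all parts are, so \<open>min x (rook_of p + 1) = k + 1\<close>
  leaves two cases: \<open>rook_of p = k < x\<close>, or \<open>rook_of p = k + 1 = x\<close>.
  For \<open>x = k + 1\<close> both occur.\<close>

lemma Cons_in_rook_class:
  "x # p \<in> rook_class (Suc k) m \<longleftrightarrow>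
     x \<in> {1..m} \<and> (p \<in> rook_class k x \<and> k < x \<or> p \<in> rook_class (Suc k) x \<and> x = Suc k)"
proof -
  have "rook_of p \<le> x" if "set p \<subseteq> {1..x}"
    using that by (intro rook_of_le_bound) auto
  moreover have "(\<forall>y\<in>set p. y \<le> x) \<and> set p \<subseteq> {1..m} \<longleftrightarrow> set p \<subseteq> {1..x}" if "x \<le> m"
    using that by fastforce
  ultimately show ?thesis
    unfolding rook_class_def by (auto simp: min_def split: if_splits)
qed

lemma rook_class_Suc_right:
  assumes "Suc k \<le> m"
  shows "rook_class (Suc k) (Suc m) = rook_class (Suc k) m \<union> Cons (Suc m) ` rook_class k (Suc m)"
proof (rule set_eqI)
  fix p
  show "p \<in> rook_class (Suc k) (Suc m) \<longleftrightarrow>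
      p \<in> rook_class (Suc k) m \<union> Cons (Suc m) ` rook_class k (Suc m)"
  proof (cases p)
    case Nil
    then show ?thesis by (auto simp: rook_class_def)
  next
    case (Cons x r)
    then show ?thesis using assms
      by (auto simp: Cons_in_rook_class image_iff le_Suc_eq)
  qed
qed

lemma Cons_Suc_notin_rook_class: "Suc m # p \<notin> rook_class k m"
  by (auto simp: rook_class_def)

lemma replicate_append_in_rook_class:
  assumes "p \<in> rook_class k (Suc k)"
  shows "replicate (Suc j) (Suc k) @ p \<in> rook_class (Suc k) (Suc k)"
  using assms by (induction j) (auto simp: Cons_in_rook_class)

text \<open>Partitions with parts at most \<open>k + 1\<close> and rook number \<open>k + 1\<close>: strip largest parts
  \<open>k + 1\<close> until the rook number drops. The number of parts stripped is well-defined because the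
  remainder has rook number \<open>k\<close>, although it may itself still contain parts \<open>k + 1\<close>.\<close>

lemma rook_class_diagonal:
  "bij_betw (\<lambda>(j, p). replicate (Suc j) (Suc k) @ p)
     (UNIV \<times> rook_class k (Suc k)) (rook_class (Suc k) (Suc k))"
proof -
  let ?h = "\<lambda>(j, p). replicate (Suc j) (Suc k) @ p"
  have disj: "p \<noteq> replicate (Suc j) (Suc k) @ r"
    if "p \<in> rook_class k (Suc k)" "r \<in> rook_class k (Suc k)" for p r j
  proof -
    have "rook_of (replicate (Suc j) (Suc k) @ r) = Suc k"
      using replicate_append_in_rook_class[OF that(2), of j]
      unfolding rook_class_def by blast
    moreover have "rook_of p = k" using that(1) by (simp add: rook_class_def)
    ultimately show ?thesis by (metis n_not_Suc_n)
  qed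
  have inj: "i = j \<and> p = r"
    if "replicate i (Suc k) @ p = replicate j (Suc k) @ r"
      "p \<in> rook_class k (Suc k)" "r \<in> rook_class k (Suc k)" for i j p r
    using that(1)
  proof (induction i arbitrary: j)
    case 0
    then show ?case using disj[OF that(2,3)] by (cases j) auto
  next
    case (Suc i)
    show ?case
    proof (cases j)
      case 0
      then show ?thesis using Suc.prems disj[OF that(3,2), of i] by simp
    next
      case (Suc j')
      then show ?thesis using Suc.IH[of j'] Suc.prems by simp
    qed
  qed
  have "inj_on ?h (UNIV \<times> rook_class k (Suc k))"
  proof (rule inj_onI, clarify)
    fix i j p r
    assume "p \<in> rook_class k (Suc k)" "r \<in> rook_class k (Suc k)"
      "replicate (Suc i) (Suc k) @ p = replicate (Suc j) (Suc k) @ r"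
    then show "i = j \<and> p = r" using inj[of "Suc i" p "Suc j" r] by blast
  qed
  moreover have "?h ` (UNIV \<times> rook_class k (Suc k)) \<subseteq> rook_class (Suc k) (Suc k)"
    using replicate_append_in_rook_class by (force simp del: replicate_Suc)
  moreover have "p \<in> ?h ` (UNIV \<times> rook_class k (Suc k))" if "p \<in> rook_class (Suc k) (Suc k)" for p
    using that
  proof (induction p)
    case Nil
    then show ?case by (simp add: rook_class_def)
  next
    case (Cons x p)
    from Cons.prems consider "x = Suc k" "p \<in> rook_class k (Suc k)"
      | "x = Suc k" "p \<in> rook_class (Suc k) (Suc k)"
      by (auto simp: Cons_in_rook_class le_Suc_eq)
    then show ?case
    proof cases
      case 1
      then show ?thesis by (intro image_eqI[of _ _ "(0, p)"]) simp_all
    next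
      case 2
      then obtain j r where "r \<in> rook_class k (Suc k)" "p = replicate (Suc j) (Suc k) @ r"
        using Cons.IH by (auto simp del: replicate_Suc)
      then show ?thesis using 2(1) by (intro image_eqI[of _ _ "(Suc j, r)"]) simp_all
    qed
  qed
  ultimately show ?thesis unfolding bij_betw_def by blast
qed

section \<open>Generating functions for bounded parts\<close>

text \<open>The \<open>j\<close>-th coefficient \<open>(-1)^j q^(j (j + 1) / 2) / ((1 - q) \<dots> (1 - q^j))\<close> of Euler's expansion
  of the infinite product of the factors \<open>1 - z q^i\<close>, \<open>i \<ge> 1\<close>, in powers of \<open>z\<close>.\<close>

primrec euler_coeff :: "'a::field \<Rightarrow> nat \<Rightarrow> 'a" where
  "euler_coeff q 0 = 1"
| "euler_coeff q (Suc j) = - (q ^ Suc j / (1 - q ^ Suc j)) * euler_coeff q j"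

text \<open>The value at \<open>q\<close> of the generating function of partitions with max-rook number \<open>k\<close>, given by
  the recursion that the boundary condition \<open>rook_class_gf_boundary\<close> imposes.\<close>

fun rook_gf :: "'a::field \<Rightarrow> nat \<Rightarrow> 'a" where
  "rook_gf q 0 = 1"
| "rook_gf q (Suc k) =
     (\<Sum>j\<le>k. rook_gf q (k - j) * euler_coeff q (Suc j) *
        (q ^ (Suc k * (j + 2)) - q ^ (Suc j * k))) / (1 - q ^ Suc k)"

text \<open>The generating function of \<open>rook_class k m\<close> in closed form, meaningful for \<open>k \<le> m\<close>.\<close>

definition rook_class_gf :: "'a::field \<Rightarrow> nat \<Rightarrow> nat \<Rightarrow> 'a" where
  "rook_class_gf q k m = (\<Sum>j\<le>k. rook_gf q (k - j) * euler_coeff q j * q ^ (j * m))"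

lemma norm_power_Suc_less_one:
  fixes q :: "'a::real_normed_field"
  assumes "norm q < 1"
  shows "norm (q ^ Suc n) < 1"
  using power_Suc_le_self[of "norm q" n] assms unfolding norm_power by simp

lemma one_minus_power_nonzero:
  fixes q :: "'a::real_normed_field"
  assumes "norm q < 1"
  shows "1 - q ^ Suc n \<noteq> 0"
  using norm_power_Suc_less_one[OF assms, of n] by (metis eq_iff_diff_eq_0 less_irrefl norm_one)

lemma rook_class_gf_Suc_right:
  fixes q :: "'a::real_normed_field"
  assumes "norm q < 1"
  shows "rook_class_gf q (Suc k) (Suc m) =
    rook_class_gf q (Suc k) m + q ^ Suc m * rook_class_gf q k (Suc m)"
proof -
  have step: "euler_coeff q (Suc j) * (q ^ (Suc j * Suc m) - q ^ (Suc j * m)) =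
      q ^ Suc m * (euler_coeff q j * q ^ (j * Suc m))" for j
  proof -
    have "q ^ (Suc j * Suc m) - q ^ (Suc j * m) = - ((1 - q ^ Suc j) * q ^ (Suc j * m))"
      by (simp add: algebra_simps power_add)
    then have "euler_coeff q (Suc j) * (q ^ (Suc j * Suc m) - q ^ (Suc j * m)) =
        q ^ Suc j * q ^ (Suc j * m) * euler_coeff q j"
      using one_minus_power_nonzero[OF assms, of j] by (simp del: power_Suc)
    then show ?thesis by (simp add: algebra_simps power_add)
  qed
  have "rook_class_gf q (Suc k) (Suc m) - rook_class_gf q (Suc k) m =
      (\<Sum>j\<le>Suc k. rook_gf q (Suc k - j) *
        (euler_coeff q j * (q ^ (j * Suc m) - q ^ (j * m))))"
    unfolding rook_class_gf_def by (simp add: sum_subtractf algebra_simps del: rook_gf.simps)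
  also have "\<dots> = (\<Sum>j\<le>k. rook_gf q (k - j) *
      (euler_coeff q (Suc j) * (q ^ (Suc j * Suc m) - q ^ (Suc j * m))))"
    by (subst sum.atMost_Suc_shift) simp
  also have "\<dots> = q ^ Suc m * rook_class_gf q k (Suc m)"
    unfolding step rook_class_gf_def sum_distrib_left by (intro sum.cong) (auto simp: algebra_simps)
  finally show ?thesis by (simp add: algebra_simps)
qed

text \<open>At \<open>m = k\<close> the closed form for rook number \<open>k + 1\<close> does not count \<open>rook_class (k + 1) k\<close>,
  which is empty. Its value there is chosen so that the recurrence in \<open>m\<close>, extended to this step,
  gives \<open>rook_class_gf_diagonal\<close>.\<close>

lemma rook_class_gf_boundary:
  fixes q :: "'a::real_normed_field"
  assumes "norm q < 1"
  shows "rook_class_gf q (Suc k) k = q ^ Suc k * rook_class_gf q (Suc k) (Suc k)"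
proof -
  have split: "rook_class_gf q (Suc k) m = rook_gf q (Suc k) +
      (\<Sum>j\<le>k. rook_gf q (k - j) * euler_coeff q (Suc j) * q ^ (Suc j * m))" for m
    unfolding rook_class_gf_def by (subst sum.atMost_Suc_shift) simp
  have exp: "q ^ (Suc k * (j + 2)) = q ^ Suc k * q ^ (Suc j * Suc k)" for j
    by (simp add: algebra_simps flip: power_add)
  have "(1 - q ^ Suc k) * rook_gf q (Suc k) =
      (\<Sum>j\<le>k. rook_gf q (k - j) * euler_coeff q (Suc j) *
        (q ^ Suc k * q ^ (Suc j * Suc k) - q ^ (Suc j * k)))"
    unfolding rook_gf.simps(2) exp
    by (rule nonzero_mult_div_cancel_left[OF one_minus_power_nonzero[OF assms],
          unfolded times_divide_eq_right[symmetric]])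
  also have "\<dots> = q ^ Suc k * (\<Sum>j\<le>k. rook_gf q (k - j) * euler_coeff q (Suc j) * q ^ (Suc j * Suc k))
      - (\<Sum>j\<le>k. rook_gf q (k - j) * euler_coeff q (Suc j) * q ^ (Suc j * k))"
    unfolding sum_distrib_left sum_subtractf[symmetric]
    by (intro sum.cong) (auto simp: algebra_simps simp del: euler_coeff.simps power_Suc)
  finally show ?thesis
    unfolding split by (simp add: algebra_simps del: euler_coeff.simps power_Suc rook_gf.simps)
qed

lemma rook_class_gf_diagonal:
  fixes q :: "'a::real_normed_field"
  assumes "norm q < 1"
  shows "rook_class_gf q (Suc k) (Suc k) =
    q ^ Suc k / (1 - q ^ Suc k) * rook_class_gf q k (Suc k)"
  using rook_class_gf_Suc_right[OF assms, of k k] rook_class_gf_boundary[OF assms, of k]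
    one_minus_power_nonzero[OF assms, of k]
  by (simp add: field_simps del: power_Suc)

lemma range_Suc_eq: "range Suc = {1..}"
  by (auto simp: image_iff Suc_le_eq gr0_conv_Suc)

lemma has_sum_geometric_times:
  fixes z :: "'a::{real_normed_field, banach}" and f :: "'b \<Rightarrow> 'a"
  assumes z: "norm z < 1" and abs: "f abs_summable_on B" and sum: "(f has_sum s) B"
  shows "(\<lambda>(j :: nat, y). z ^ Suc j * f y) abs_summable_on UNIV \<times> B"
    and "((\<lambda>(j :: nat, y). z ^ Suc j * f y) has_sum z / (1 - z) * s) (UNIV \<times> B)"
proof -
  have geom: "((\<lambda>j. w ^ Suc j) has_sum w / (1 - w)) UNIV"
    if "norm w < 1" for w :: "'c::{real_normed_field, banach}"
  proof -
    have "((\<lambda>n. w ^ n) has_sum w / (1 - w)) (range Suc)"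
      using has_sum_geometric_from_1[OF that] by (simp add: range_Suc_eq)
    then show ?thesis by (subst (asm) has_sum_reindex) (auto simp: o_def)
  qed
  show *: "(\<lambda>(j :: nat, y). z ^ Suc j * f y) abs_summable_on UNIV \<times> B"
  proof (subst abs_summable_on_Sigma_iff, intro conjI ballI)
    fix j :: nat
    show "(\<lambda>y. case (j, y) of (j, y) \<Rightarrow> z ^ Suc j * f y) abs_summable_on B"
      using abs by (simp add: norm_mult summable_on_cmult_right del: power_Suc)
  next
    have "(\<lambda>j. norm z ^ Suc j) summable_on UNIV"
      using geom[of "norm z"] z by (auto simp: summable_on_def)
    then show "(\<lambda>j::nat. \<Sum>\<^sub>\<infinity>y\<in>B. norm (case (j, y) of (j, y) \<Rightarrow> z ^ Suc j * f y)) abs_summable_on UNIV"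
      using abs by (simp add: norm_mult norm_power infsum_cmult_right abs_mult infsum_nonneg
          summable_on_cmult_left del: power_Suc)
  qed
  show "((\<lambda>(j :: nat, y). z ^ Suc j * f y) has_sum z / (1 - z) * s) (UNIV \<times> B)"
  proof (rule has_sum_SigmaI)
    show "((\<lambda>y. case (j, y) of (j, y) \<Rightarrow> z ^ Suc j * f y) has_sum z ^ Suc j * s) B" for j
      using has_sum_cmult_right[OF sum, of "z ^ Suc j"] by simp
    show "((\<lambda>j. z ^ Suc j * s) has_sum z / (1 - z) * s) UNIV"
      by (rule has_sum_cmult_left[OF geom[OF z]])
  qed (rule abs_summable_summable[OF *])
qed

lemma has_sum_rook_class:
  fixes q :: "'a::{real_normed_field, banach}"
  assumes q: "norm q < 1" and "k \<le> m"
  shows "(\<lambda>p. q ^ sum_list p) abs_summable_on rook_class k m \<and>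
    ((\<lambda>p. q ^ sum_list p) has_sum rook_class_gf q k m) (rook_class k m)"
  using \<open>k \<le> m\<close>
proof (induction k arbitrary: m)
  case 0
  have "((\<lambda>p. q ^ sum_list p) has_sum (\<Sum>p\<in>{[]}. q ^ sum_list p)) {[]}"
    by (rule has_sum_finite) simp
  then show ?case by (simp add: rook_class_0 rook_class_gf_def)
next
  case (Suc k)
  from Suc.prems show ?case
  proof (induction m rule: dec_induct)
    case base
    let ?h = "\<lambda>(j, p). replicate (Suc j) (Suc k) @ p"
    have eq: "q ^ sum_list (?h x) = (case x of (j, p) \<Rightarrow> (q ^ Suc k) ^ Suc j * q ^ sum_list p)" for x
      by (cases x) (simp add: sum_list_replicate mult.commute add.commute flip: power_mult power_add del: replicate_Suc power_Suc mult_Suc mult_Suc_right)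
    have "norm (q ^ Suc k) < 1"
      using norm_power_Suc_less_one[OF q] .
    note prod = has_sum_geometric_times[OF this
        conjunct1[OF Suc.IH[OF le_SucI[OF order_refl]]]
        conjunct2[OF Suc.IH[OF le_SucI[OF order_refl]]]]
    have "(\<lambda>p. q ^ sum_list p) abs_summable_on rook_class (Suc k) (Suc k)"
      using prod(1) summable_on_reindex_bij_betw[OF rook_class_diagonal[of k],
          of "\<lambda>p. norm (q ^ sum_list p)"] unfolding eq by simp
    moreover have "((\<lambda>p. q ^ sum_list p) has_sum rook_class_gf q (Suc k) (Suc k))
        (rook_class (Suc k) (Suc k))"
      using prod(2) has_sum_reindex_bij_betw[OF rook_class_diagonal[of k],
          of "\<lambda>p. q ^ sum_list p"] unfolding eq rook_class_gf_diagonal[OF q] by simp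
    ultimately show ?case ..
  next
    case (step m)
    let ?C = "Cons (Suc m) ` rook_class k (Suc m)"
    have inj: "inj_on (Cons (Suc m)) (rook_class k (Suc m))" by (simp add: inj_on_def)
    have IH: "(\<lambda>p. q ^ sum_list p) abs_summable_on rook_class k (Suc m)"
       "((\<lambda>p. q ^ sum_list p) has_sum rook_class_gf q k (Suc m)) (rook_class k (Suc m))"
      using Suc.IH[of "Suc m"] step.hyps by auto
    have abs: "(\<lambda>p. q ^ sum_list p) abs_summable_on ?C"
      using summable_on_cmult_right[OF IH(1), of "norm (q ^ Suc m)"]
      by (subst summable_on_reindex[OF inj])
         (simp add: o_def power_add norm_mult norm_power mult.assoc)
    have sum: "((\<lambda>p. q ^ sum_list p) has_sum q ^ Suc m * rook_class_gf q k (Suc m)) ?C"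
      using has_sum_cmult_right[OF IH(2), of "q ^ Suc m"]
      by (subst has_sum_reindex[OF inj]) (simp add: o_def power_add mult.assoc)
    have disj: "rook_class (Suc k) m \<inter> ?C = {}"
      using Cons_Suc_notin_rook_class by blast
    show ?case
      unfolding rook_class_Suc_right[OF step.hyps(1)] rook_class_gf_Suc_right[OF q]
      using summable_on_Un_disjoint[OF conjunct1[OF step.IH] abs disj]
        has_sum_Un_disjoint[OF conjunct2[OF step.IH] sum disj] by blast
  qed
qed

section \<open>Partitions with unbounded parts\<close>

text \<open>All partitions with max-rook number \<open>k\<close>.\<close>

definition rook_partitions :: "nat \<Rightarrow> nat list set" where
  "rook_partitions k = (\<Union>m. rook_class k m)"

lemma rook_class_mono: "m \<le> m' \<Longrightarrow> rook_class k m \<subseteq> rook_class k m'"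
  by (auto simp: rook_class_def)

lemma rook_class_gf_tendsto:
  fixes q :: "'a::real_normed_field"
  assumes "norm q < 1"
  shows "(\<lambda>m. rook_class_gf q k m) \<longlonglongrightarrow> rook_gf q k"
proof -
  have "(\<lambda>m. rook_gf q (k - j) * euler_coeff q j * q ^ (j * m)) \<longlonglongrightarrow>
      (if j = 0 then rook_gf q k else 0)" for j
  proof (cases j)
    case (Suc i)
    have "norm (q ^ j) < 1"
      using norm_power_Suc_less_one[OF assms] Suc by blast
    then have "(\<lambda>m. rook_gf q (k - j) * euler_coeff q j * (q ^ j) ^ m) \<longlonglongrightarrow> 
        rook_gf q (k - j) * euler_coeff q j * 0"
      by (intro tendsto_intros LIMSEQ_power_zero)
    then show ?thesis using Suc by (simp add: power_mult del: euler_coeff.simps power_Suc mult_Suc)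
  qed simp
  then have "(\<lambda>m. \<Sum>j\<le>k. rook_gf q (k - j) * euler_coeff q j * q ^ (j * m)) \<longlonglongrightarrow>
      (\<Sum>j\<le>k. if j = 0 then rook_gf q k else 0)"
    by (rule tendsto_sum)
  then show ?thesis by (simp add: rook_class_gf_def)
qed

text \<open>Every finite set of partitions lies in some \<open>rook_class k m\<close>, so the finite sums are bounded
  by the convergent sequence \<open>rook_class_gf \<bar>q\<bar> k m\<close>, \<open>m = 0, 1, 2, \<dots>\<close>\<close>

lemma abs_summable_on_rook_partitions:
  fixes q :: "'a::{real_normed_field, banach}"
  assumes "norm q < 1"
  shows "(\<lambda>p. q ^ sum_list p) abs_summable_on rook_partitions k"
proof (rule nonneg_bdd_above_summable_on)
  obtain K where K: "\<And>m. norm (rook_class_gf (norm q) k m) \<le> K"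
    using convergent_imp_Bseq[OF convergentI[OF rook_class_gf_tendsto[of "norm q" k]]] assms
    by (auto simp: Bseq_def)
  show "bdd_above (sum (\<lambda>p. norm (q ^ sum_list p)) ` {F. F \<subseteq> rook_partitions k \<and> finite F})"
  proof (rule bdd_aboveI2)
    fix F assume F: "F \<in> {F. F \<subseteq> rook_partitions k \<and> finite F}"
    have "\<exists>m\<ge>k. F \<subseteq> rook_class k m"
    proof -
      from F have "finite F" "F \<subseteq> rook_partitions k" by auto
      then show ?thesis
      proof (induction F rule: finite_induct)
        case (insert p F)
        then obtain m m' where "k \<le> m" "F \<subseteq> rook_class k m" "p \<in> rook_class k m'"
          by (auto simp: rook_partitions_def)
        then show ?case
          using rook_class_mono[of m "max m m'" k] rook_class_mono[of m' "max m m'" k]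
          by (intro exI[of _ "max m m'"]) auto
      qed auto
    qed
    then obtain m where m: "k \<le> m" "F \<subseteq> rook_class k m" by blast
    have "((\<lambda>p. norm q ^ sum_list p) has_sum rook_class_gf (norm q) k m) (rook_class k m)"
      using has_sum_rook_class[of "norm q" k m] assms m(1) by simp
    then have "sum (\<lambda>p. norm q ^ sum_list p) F \<le> rook_class_gf (norm q) k m"
      by (rule finite_sum_le_has_sum) (use F m in auto)
    then show "sum (\<lambda>p. norm (q ^ sum_list p)) F \<le> K"
      using K[of m] by (simp add: norm_power)
  qed
qed simp

lemma has_sum_fibres_sums:
  fixes f :: "'b \<Rightarrow> 'a::{real_normed_vector}" and h :: "'b \<Rightarrow> nat"
  assumes f: "(f has_sum s) U" and g: "\<And>n. (f has_sum g n) {x \<in> U. h x = n}"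
  shows "g sums s"
proof -
  have "bij_betw snd (SIGMA n:UNIV. {x \<in> U. h x = n}) U"
    by (rule bij_betwI[where g = "\<lambda>x. (h x, x)"]) auto
  then have "((\<lambda>y. f (snd y)) has_sum s) (SIGMA n:UNIV. {x \<in> U. h x = n})"
    using f has_sum_reindex_bij_betw by blast
  then have "(g has_sum s) UNIV"
    by (rule has_sum_SigmaD) (use g in simp)
  then show ?thesis by (rule has_sum_imp_sums)
qed

text \<open>Continuity of unconditional summation along an increasing sequence of sets: split the union
  according to the first set in which a point appears.\<close>

lemma has_sum_incseq_tendsto:
  fixes f :: "'b \<Rightarrow> 'a::real_normed_vector"
  assumes S: "incseq S" and f: "(f has_sum s) (\<Union>n. S n)" and g: "\<And>n. (f has_sum g n) (S n)"
  shows "g \<longlonglongrightarrow> s"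
proof -
  define h where "h x = (LEAST n. x \<in> S n)" for x
  define d where "d n = (case n of 0 \<Rightarrow> g 0 | Suc m \<Rightarrow> g (Suc m) - g m)" for n
  have h_iff: "h x \<le> n \<longleftrightarrow> x \<in> S n" if "x \<in> (\<Union>n. S n)" for x n
  proof
    from that have "x \<in> S (h x)" unfolding h_def by (auto intro: LeastI)
    then show "h x \<le> n \<Longrightarrow> x \<in> S n" using monoD[OF S, of "h x" n] by blast
  qed (simp add: h_def Least_le)
  have "(f has_sum d n) {x \<in> (\<Union>n. S n). h x = n}" for n
  proof (cases n)
    case 0
    then have "{x \<in> (\<Union>n. S n). h x = n} = S 0" using h_iff[of _ 0] by auto
    then show ?thesis using g[of 0] 0 by (simp add: d_def)
  next
    case (Suc m)
    have "{x \<in> (\<Union>n. S n). h x = n} = S (Suc m) - S m"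
    proof (rule set_eqI)
      fix x
      have "h x = Suc m \<longleftrightarrow> h x \<le> Suc m \<and> \<not> h x \<le> m" by linarith
      then show "x \<in> {x \<in> (\<Union>n. S n). h x = n} \<longleftrightarrow> x \<in> S (Suc m) - S m"
        using h_iff[of x m] h_iff[of x "Suc m"] Suc by auto
    qed
    then show ?thesis
      using has_sum_Diff[OF g g monoD[OF S le_SucI[OF order_refl]], of m] Suc by (simp add: d_def)
  qed
  then have "d sums s" by (rule has_sum_fibres_sums[OF f])
  moreover have "(\<Sum>i\<le>n. d i) = g n" for n
    by (induction n) (auto simp: d_def)
  ultimately show ?thesis by (simp add: sums_def_le)
qed

lemma has_sum_rook_partitions:
  fixes q :: "'a::{real_normed_field, banach}"
  assumes q: "norm q < 1"
  shows "((\<lambda>p. q ^ sum_list p) has_sum rook_gf q k) (rook_partitions k)"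
proof -
  obtain s where s: "((\<lambda>p. q ^ sum_list p) has_sum s) (\<Union>m. rook_class k m)"
    using abs_summable_summable[OF abs_summable_on_rook_partitions[OF q]]
    unfolding rook_partitions_def by (auto simp: summable_on_def)
  have "((\<lambda>p. q ^ sum_list p) has_sum (if m < k then 0 else rook_class_gf q k m)) (rook_class k m)" for m
    using has_sum_rook_class[OF q, of k m] by (auto simp: rook_class_empty)
  with s have "(\<lambda>m. if m < k then 0 else rook_class_gf q k m) \<longlonglongrightarrow> s"
    by (intro has_sum_incseq_tendsto[OF monoI[OF rook_class_mono]])
  moreover have "eventually (\<lambda>m. (if m < k then 0 else rook_class_gf q k m) = rook_class_gf q k m) sequentially"
    using eventually_ge_at_top[of k] by eventually_elim simp
  ultimately have "(\<lambda>m. rook_class_gf q k m) \<longlonglongrightarrow> s"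
    using tendsto_cong by fast
  then have "s = rook_gf q k"
    using rook_class_gf_tendsto[OF q] LIMSEQ_unique by blast
  then show ?thesis using s by (simp add: rook_partitions_def)
qed

lemma finite_partitions_of: "finite (partitions_of n)"
proof (rule finite_subset)
  show "partitions_of n \<subseteq> {p. set p \<subseteq> {..n} \<and> length p \<le> n}"
  proof
    fix p assume p: "p \<in> partitions_of n"
    then have "\<forall>x\<in>set p. 0 < x" by (simp add: partitions_of_def)
    then have "length p \<le> sum_list p" by (induction p) auto
    then show "p \<in> {p. set p \<subseteq> {..n} \<and> length p \<le> n}"
      using p by (auto simp: partitions_of_def intro: member_le_sum_list)
  qed
qed (simp add: finite_lists_length_le)

lemma rook_partitions_fibre:
  "{p \<in> rook_partitions k. sum_list p = n} = {p \<in> partitions_of n. max_rook p = k}"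
proof -
  have "\<exists>m. set p \<subseteq> {1..m}" if "\<forall>x\<in>set p. 0 < x" for p :: "nat list"
    using that by (intro exI[of _ "sum_list p"]) (auto intro: member_le_sum_list simp: Suc_le_eq)
  then show ?thesis
    by (auto simp: rook_partitions_def rook_class_def partitions_of_def max_rook_eq_rook_of
        subset_iff Suc_le_eq)
qed

theorem rook_count_sums:
  fixes q :: "'a::{real_normed_field, banach}"
  assumes "norm q < 1"
  shows "(\<lambda>n. of_nat (rook_count k n) * q ^ n) sums rook_gf q k"
proof (rule has_sum_fibres_sums[OF has_sum_rook_partitions[OF assms]])
  fix n
  have "finite {p \<in> partitions_of n. max_rook p = k}"
    by (simp add: finite_partitions_of)
  then have "((\<lambda>p. q ^ sum_list p) has_sum (\<Sum>p | p \<in> partitions_of n \<and> max_rook p = k. q ^ sum_list p))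
     {p \<in> partitions_of n. max_rook p = k}"
    by (rule has_sum_finite)
  also have "(\<Sum>p | p \<in> partitions_of n \<and> max_rook p = k. q ^ sum_list p) =
      of_nat (rook_count k n) * q ^ n"
    by (simp add: partitions_of_def rook_count_def)
  finally show "((\<lambda>p. q ^ sum_list p) has_sum of_nat (rook_count k n) * q ^ n)
      {p \<in> rook_partitions k. sum_list p = n}"
    unfolding rook_partitions_fibre .
qed

section \<open>Rook number four\<close>

lemma rook_gf_4:
  fixes q :: "'a::real_normed_field"
  assumes "norm q < 1"
  shows "rook_gf q 4 = q^10 * (1 + 4*q + 6*q^2 + 7*q^3 + 6*q^4 + 2*q^5 - 5*q^7 - 5*q^8 - 5*q^9
              + q^11 + 3*q^12 + 2*q^13 - q^16)
      / ((1 - q) * (1 - q^2) * (1 - q^3) * (1 - q^4))"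
proof -
  \<comment> \<open>The factors of the denominators, kept abstract while fractions are combined.\<close>
  define d s t u where "d = 1 - q" and "s = 1 + q" and "t = 1 + q + q^2" and "u = 1 + q^2"
  have d2: "1 - q^2 = d * s" and d3: "1 - q^3 = d * t" and d4: "1 - q^4 = d * s * u"
    unfolding d_def s_def t_def u_def by algebra+
  have "1 - q^1 \<noteq> 0" "1 - q^2 \<noteq> 0" "1 - q^3 \<noteq> 0" "1 - q^4 \<noteq> 0"
    using one_minus_power_nonzero[OF assms, of 0] one_minus_power_nonzero[OF assms, of 1]
      one_minus_power_nonzero[OF assms, of 2] one_minus_power_nonzero[OF assms, of 3]
    by (simp_all add: numeral_eq_Suc)
  then have nz: "d \<noteq> 0" "s \<noteq> 0" "t \<noteq> 0" "u \<noteq> 0"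
    unfolding d2 d3 d4 by (auto simp: d_def)
  have c1: "euler_coeff q 1 = - q / d"
    by (simp add: d_def)
  have c2: "euler_coeff q 2 = q^3 / (d^2 * s)"
    using nz euler_coeff.simps(2)[of q 1] unfolding Suc_1 c1 d2
    by (simp add: field_simps numeral_eq_Suc)
  have c3: "euler_coeff q 3 = - (q^6) / (d^3 * s * t)"
    using nz euler_coeff.simps(2)[of q 2]
    by (simp add: c2 d3 flip: numeral_3_eq_3 del: power_Suc) (simp add: field_simps numeral_eq_Suc)
  have c4: "euler_coeff q 4 = q^10 / (d^4 * s^2 * t * u)"
    using nz euler_coeff.simps(2)[of q 3]
    by (simp add: c3 d4 del: power_Suc) (simp add: field_simps numeral_eq_Suc)
  have "rook_gf q 1 = euler_coeff q 1 * (q^2 - 1) / (1 - q)"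
    by (simp add: numeral_eq_Suc)
  then have a1: "rook_gf q 1 = q * s / d"
    using nz unfolding c1 d_def[symmetric] minus_diff_eq[of 1 "q^2", symmetric] d2
    by (simp add: field_simps)
  have "rook_gf q 2 = (rook_gf q 1 * euler_coeff q 1 * (q^4 - q) +
      euler_coeff q 2 * (q^6 - q^2)) / (1 - q^2)"
    using rook_gf.simps(2)[of q 1]
    by (simp add: numeral_eq_Suc del: rook_gf.simps(2) euler_coeff.simps power_Suc)
  then have a2: "rook_gf q 2 = q^3 * (1 + 2*q + q^2 + q^3 - q^4) / (d^2 * s)"
    using nz unfolding a1 c1 c2 d2
    by (simp add: divide_simps, unfold d_def s_def, algebra)
  have "rook_gf q 3 = (rook_gf q 2 * euler_coeff q 1 * (q^6 - q^2) +
      rook_gf q 1 * euler_coeff q 2 * (q^9 - q^4) +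
      euler_coeff q 3 * (q^12 - q^6)) / (1 - q^3)"
    using rook_gf.simps(2)[of q 2]
    by (simp add: numeral_eq_Suc del: rook_gf.simps(2) euler_coeff.simps power_Suc)
  then have a3: "rook_gf q 3 =
      q^6 * (1 + 3*q + 3*q^2 + 3*q^3 + q^4 - q^5 - q^6 - 2*q^7 + q^9) / (d^3 * s * t)"
    using nz unfolding a1 a2 c1 c2 c3 d3
    by (simp add: divide_simps, unfold d_def s_def t_def, algebra)
  have rec: "rook_gf q 4 = (rook_gf q 3 * euler_coeff q 1 * (q^8 - q^3) +
     rook_gf q 2 * euler_coeff q 2 * (q^12 - q^6) +
     rook_gf q 1 * euler_coeff q 3 * (q^16 - q^9) +
     euler_coeff q 4 * (q^20 - q^12)) / (1 - q^4)"
    using rook_gf.simps(2)[of q 3]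
    by (simp add: numeral_eq_Suc del: rook_gf.simps(2) euler_coeff.simps power_Suc)
  have frac: "(p3 / (d^3 * s * t) * (p1' / d) * w1 + p2 / (d^2 * s) * (p2' / (d^2 * s)) * w2 +
      p1 / d * (p3' / (d^3 * s * t)) * w3 + p4' / (d^4 * s^2 * t * u) * w4) / (d * s * u) =
    ((p3 * p1' * w1 + p1 * p3' * w3) * s * u + p2 * p2' * w2 * t * u + p4' * w4) / 
     ((d^4 * s^2 * t * u) * (d * s * u))" for p1 p1' p2 p2' p3 p3' p4' w1 w2 w3 w4 :: 'a
    using nz by (simp add: field_simps numeral_eq_Suc)
  \<comment> \<open>The common denominator \<open>d^4 * s^2 * t * u\<close> of the bracket in \<open>rec\<close> is also the denominator
    of the claim, so the numerator of \<open>rec\<close> is divisible by \<open>1 - q^4\<close>.\<close>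
  have den: "d * (d * s) * (d * t) * (d * s * u) = d^4 * s^2 * t * u" by algebra
  show ?thesis
    unfolding rec a1 a2 a3 c1 c2 c3 c4 d2 d3 d4 frac
    unfolding d_def[symmetric] den
    by (subst frac_eq_eq, simp add: nz, simp add: nz, unfold d_def s_def t_def u_def, algebra)
qed

theorem theorem3p4:
  fixes q :: complex
  assumes "norm q < 1"
  shows "(\<lambda>n. of_nat (rook_count 4 (Suc n)) * q ^ Suc n) sums
    (q^10 * (1 + 4*q + 6*q^2 + 7*q^3 + 6*q^4 + 2*q^5 - 5*q^7 - 5*q^8 - 5*q^9
              + q^11 + 3*q^12 + 2*q^13 - q^16)
      / ((1 - q) * (1 - q^2) * (1 - q^3) * (1 - q^4)))"
proof -
  \<comment> \<open>The series starts at \<open>n = 1\<close>; the term at \<open>0\<close> vanishes since the empty partition has rook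
    number \<open>0\<close>.\<close>
  have "partitions_of 0 = {[]}"
    by (auto simp: partitions_of_def) (metis list.set_intros(1) neq_Nil_conv less_irrefl)
  then have "rook_count 4 0 = 0"
    by (auto simp: rook_count_def max_rook_eq_rook_of)
  then show ?thesis
    using rook_count_sums[OF assms, of 4] unfolding rook_gf_4[OF assms]
    by (subst sums_Suc_iff) simp
qed

end
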